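(* For every real $q$ with $1<q<3$, the $q$-Gaussian distribution (the probability distribution on $\mathbb{R}$ with density $g_q$) is a variance mixture of normals. For every real $q<1$, the $q$-Gaussian distribution is not a variance mixture of normals.
   Context: For $q\in(-\infty,3)$, $q\neq 1$, the $q$-Gaussian distribution is the probability distribution on $\mathbb{R}$ with density $$g_q(x)=C_q\,[1-(1-q)x^2]^{1/(1-q)}$$ on its support, and $0$ elsewhere, where the support is all of $\mathbb{R}$ if $1<q<3$ and is the compact interval $\left[-\frac{1}{\sqrt{1-q}},\frac{1}{\sqrt{1-q}}\right]$ if $q<1$. The normalizing constant $C_q$ is given by $$C_q^{-1}=\frac{2\sqrt{\pi}\,\Gamma\left(\frac{1}{1-q}\right)}{(3-q)\sqrt{1-q}\,\Gamma\left(\frac{3-q}{2(1-q)}\right)}\quad\text{if } q<1,\qquad C_q^{-1}=\frac{\sqrt{\pi}\,\Gamma\left(\frac{3-q}{2(q-1)}\right)}{\sqrt{q-1}\,\Gamma\left(\frac{1}{q-1}\right)}\quad\text{if } 1<q<3.$$ A probability distribution on $\mathbb{R}$ is a variance mixture of normals if its characteristic function has the form $\phi(t)=\int_{[0,\infty)}\exp(-t^2u/2)\,dH(u)$, $t\in\mathbb{R}$, for some probability distribution function $H$ on $[0,\infty)$. *)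

theory Defs
  imports "HOL-Probability.Probability"
begin

definition q_gaussian_support :: "real \<Rightarrow> real set" where
  "q_gaussian_support q =
     (if q < 1 then {- (1 / sqrt (1 - q)) .. 1 / sqrt (1 - q)} else UNIV)"

text \<open>
  The intended range of the parameter is \<open>q < 3\<close>, \<open>q \<noteq> 1\<close>; outside of it the values below are junk.
\<close>

definition q_gaussian_const :: "real \<Rightarrow> real" where
  "q_gaussian_const q =
     inverse
       (if q < 1
        then 2 * sqrt pi * Gamma (1 / (1 - q)) /
               ((3 - q) * sqrt (1 - q) * Gamma ((3 - q) / (2 * (1 - q))))
        else sqrt pi * Gamma ((3 - q) / (2 * (q - 1))) /
               (sqrt (q - 1) * Gamma (1 / (q - 1))))"

text \<open>
  On the support the base of the power is nonnegative. It vanishes only at the endpoints for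
  \<open>q < 1\<close>, where the exponent is positive, so \<open>0 powr a = 0\<close> is the right value there.
\<close>

definition q_gaussian_density :: "real \<Rightarrow> real \<Rightarrow> real" where
  "q_gaussian_density q x =
     (if x \<in> q_gaussian_support q
      then q_gaussian_const q * (1 - (1 - q) * x\<^sup>2) powr (1 / (1 - q))
      else 0)"

definition q_gaussian :: "real \<Rightarrow> real measure" where
  "q_gaussian q = density lborel (\<lambda>x. ennreal (q_gaussian_density q x))"

text \<open>
  A distribution function on \<open>[0, \<infinity>)\<close> is regarded as a function on the whole line vanishing on the
  negative half-line; it may jump at 0, i.e. the distribution may have an atom there.
\<close>

definition prob_distribution_function_nonneg :: "(real \<Rightarrow> real) \<Rightarrow> bool" where
  "prob_distribution_function_nonneg H \<longleftrightarrow>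
     mono H \<and> (\<forall>u. continuous (at_right u) H) \<and>
     (\<forall>u<0. H u = 0) \<and> (H \<longlongrightarrow> 1) at_top"

text \<open>
  \<open>interval_measure H\<close> is the Lebesgue-Stieltjes measure of \<open>H\<close>; the integral over \<open>{0..}\<close> includes
  the contribution \<open>H 0\<close> of a possible atom at 0.
\<close>

definition variance_mixture_of_normals :: "real measure \<Rightarrow> bool" where
  "variance_mixture_of_normals M \<longleftrightarrow>
     (\<exists>H. prob_distribution_function_nonneg H \<and>
        (\<forall>t. char M t =
           complex_of_real (LINT u:{0..}|interval_measure H. exp (- (t\<^sup>2 * u / 2)))))"

end

theory Submission
  imports Defs
begin

text \<open>
  For \<open>1 < q < 3\<close> put \<open>b = 1 / (q - 1)\<close>. Since \<open>y powr - b\<close> is the integral of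
  \<open>v powr (b - 1) * exp (- (y * v)) / Gamma b\<close> over \<open>v > 0\<close>, the density \<open>(1 + (q - 1) * x\<^sup>2) powr - b\<close>
  is up to a constant a mixture of centred Gaussians of variance \<open>1 / (2 * (q - 1) * V)\<close>, where \<open>V\<close>
  has the Gamma distribution of shape \<open>b - 1 / 2\<close> because the Gaussian normalisation takes up a
  factor \<open>sqrt V\<close>.

  For \<open>q < 1\<close> the support is bounded. By Levy's uniqueness theorem a variance mixture of normals is
  the law of \<open>sqrt U * Z\<close> with \<open>Z\<close> standard normal and independent of \<open>U \<ge> 0\<close>, which is bounded
  only if \<open>U = 0\<close> almost surely. Then it is a point mass at 0 and has no density.
\<close>

section \<open>Mixing laws on the half-line\<close>

text \<open>Distribution functions and real distributions correspond through \<open>cdf\<close> and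
  \<open>interval_measure\<close>. Working with a mixing law \<open>N\<close> makes product
  measures, image measures and Fubini available.\<close>

lemma variance_mixture_of_normals_iff:
  "variance_mixture_of_normals M \<longleftrightarrow>
     (\<exists>N. real_distribution N \<and> (AE u in N. 0 \<le> u) \<and>
        (\<forall>t. char M t = complex_of_real (LINT u|N. exp (- (t\<^sup>2 * u / 2)))))"
proof
  assume "variance_mixture_of_normals M"
  then obtain H where H: "mono H" "\<And>u. continuous (at_right u) H" "\<And>u. u < 0 \<Longrightarrow> H u = 0"
      "(H \<longlongrightarrow> 1) at_top"
    and char: "\<And>t. char M t = complex_of_real (LINT u:{0..}|interval_measure H. exp (- (t\<^sup>2 * u / 2)))"
    unfolding variance_mixture_of_normals_def prob_distribution_function_nonneg_def by blast
  have bot: "(H \<longlongrightarrow> 0) at_bot"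
    by (rule tendsto_eventually) (auto simp: eventually_at_bot_linorder H(3) intro!: exI[of _ "-1"])
  define N where "N = interval_measure H"
  have rd: "real_distribution N"
    unfolding N_def using H bot by (intro real_distribution_interval_measure) (auto dest: monoD)
  interpret N: real_distribution N by fact
  have cdf: "cdf N = H"
    unfolding N_def using H bot by (intro cdf_interval_measure) (auto dest: monoD)
  \<comment> \<open>The left limit of a distribution function at 0 is the mass of the open negative
    half-line, so \<open>N\<close> lives on \<open>{0..}\<close>.\<close>
  have "(cdf N \<longlongrightarrow> 0) (at_left 0)"
    unfolding cdf by (rule tendsto_eventually) (auto simp: eventually_at_left_field H(3) intro!: exI[of _ "-1"])
  then have "measure N {..<0} = 0"
    by (rule tendsto_unique[OF _ N.cdf_at_left, rotated]) simp
  then have "AE u in N. u \<notin> {..<0}"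
    by (subst (asm) N.prob_eq_0) auto
  then have nonneg: "AE u in N. 0 \<le> u"
    by eventually_elim auto
  have "(LINT u:{0..}|N. exp (- (t\<^sup>2 * u / 2))) = (LINT u|N. exp (- (t\<^sup>2 * u / 2)))" for t
    unfolding set_lebesgue_integral_def
    by (rule integral_cong_AE) (use nonneg in auto)
  with rd nonneg char show "\<exists>N. real_distribution N \<and> (AE u in N. 0 \<le> u) \<and>
        (\<forall>t. char M t = complex_of_real (LINT u|N. exp (- (t\<^sup>2 * u / 2))))"
    unfolding N_def by auto
next
  assume "\<exists>N. real_distribution N \<and> (AE u in N. 0 \<le> u) \<and>
        (\<forall>t. char M t = complex_of_real (LINT u|N. exp (- (t\<^sup>2 * u / 2))))"
  then obtain N where rd: "real_distribution N" and nonneg: "AE u in N. 0 \<le> u"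
    and char: "\<And>t. char M t = complex_of_real (LINT u|N. exp (- (t\<^sup>2 * u / 2)))"
    by blast
  interpret N: real_distribution N by fact
  \<comment> \<open>Both sides have the same distribution function, which determines a real
    distribution.\<close>
  have eq: "interval_measure (cdf N) = N"
    by (intro cdf_unique real_distribution_interval_measure rd cdf_interval_measure
        N.cdf_nondecreasing N.cdf_is_right_cont N.cdf_lim_at_bot N.cdf_lim_at_top_prob)
  have "cdf N u = 0" if "u < 0" for u
  proof -
    have "AE x in N. x \<notin> {..u}"
      using nonneg by eventually_elim (use that in auto)
    then show ?thesis
      unfolding cdf_def by (subst N.prob_eq_0) auto
  qed
  then have "prob_distribution_function_nonneg (cdf N)"
    unfolding prob_distribution_function_nonneg_def
    using N.cdf_nondecreasing N.cdf_is_right_cont N.cdf_lim_at_top_prob by (auto intro!: monoI)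
  moreover have "(LINT u|N. exp (- (t\<^sup>2 * u / 2))) = (LINT u:{0..}|N. exp (- (t\<^sup>2 * u / 2)))" for t
    unfolding set_lebesgue_integral_def
    by (rule integral_cong_AE) (use nonneg in auto)
  ultimately show "variance_mixture_of_normals M"
    unfolding variance_mixture_of_normals_def using char eq by (auto intro!: exI[of _ "cdf N"])
qed

section \<open>Densities that are mixtures of normal densities\<close>

lemma char_normal_density:
  assumes "\<sigma> > 0"
  shows "(CLINT x|lborel. normal_density 0 \<sigma> x *\<^sub>R iexp (t * x)) = complex_of_real (exp (- (t\<^sup>2 * \<sigma>\<^sup>2 / 2)))"
proof -
  have scale: "\<sigma> * normal_density 0 \<sigma> (\<sigma> * x) = std_normal_density x" for x
    using assms by (simp add: normal_density_def real_sqrt_mult power_mult_distrib)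
  have "(CLINT x|lborel. normal_density 0 \<sigma> x *\<^sub>R iexp (t * x))
      = \<bar>\<sigma>\<bar> *\<^sub>R (CLINT x|lborel. normal_density 0 \<sigma> (0 + \<sigma> * x) *\<^sub>R iexp (t * (0 + \<sigma> * x)))"
    using assms by (intro lborel_integral_real_affine) auto
  also have "\<dots> = (CLINT x|lborel. std_normal_density x *\<^sub>R iexp (t * \<sigma> * x))"
    unfolding integral_scaleR_right[symmetric] using assms
    by (intro Bochner_Integration.integral_cong) (auto simp: scale[symmetric] mult_ac)
  also have "\<dots> = char std_normal_distribution (t * \<sigma>)"
    unfolding char_def by (subst integral_density) auto
  also have "\<dots> = complex_of_real (exp (- (t\<^sup>2 * \<sigma>\<^sup>2 / 2)))"
    by (simp add: char_std_normal_distribution power_mult_distrib)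
  finally show ?thesis .
qed

text \<open>Fubini moves the Fourier integral inside the mixture, where each normal density
  contributes its characteristic function. The variance must be positive almost surely:
  \<open>normal_density 0 0\<close> is 0, so it cannot represent a point mass.\<close>

lemma variance_mixture_of_normals_density:
  assumes "real_distribution N" and pos: "AE u in N. 0 < u"
    and [measurable]: "g \<in> borel_measurable borel"
    and g: "\<And>x. g x = (LINT u|N. normal_density 0 (sqrt u) x)"
  shows "variance_mixture_of_normals (density lborel (\<lambda>x. ennreal (g x)))"
  unfolding variance_mixture_of_normals_iff
proof (intro exI[of _ N] conjI allI)
  interpret N: real_distribution N by fact
  interpret P: pair_sigma_finite N lborel ..
  have [measurable]: "(\<lambda>p. normal_density 0 (sqrt (fst p)) (snd p)) \<in> borel_measurable (N \<Otimes>\<^sub>M borel)"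
    unfolding normal_density_def by measurable
  fix t :: real
  have kernel: "(CLINT x|lborel. normal_density 0 (sqrt u) x *\<^sub>R iexp (t * x)) =
      complex_of_real (exp (- (t\<^sup>2 * u / 2)))" if "0 < u" for u
    using char_normal_density[of "sqrt u" t] that by simp
  have int: "integrable (N \<Otimes>\<^sub>M lborel) (\<lambda>(u, x). normal_density 0 (sqrt u) x *\<^sub>R iexp (t * x))"
  proof (rule P.Fubini_integrable)
    show "AE u in N. integrable lborel
        (\<lambda>x. case (u, x) of (u, x) \<Rightarrow> normal_density 0 (sqrt u) x *\<^sub>R iexp (t * x))"
      using pos
    proof eventually_elim
      case (elim u)
      then show ?case
        by (intro Bochner_Integration.integrable_bound[OF integrable_normal_density[of "sqrt u" 0]]) auto
    qed
    \<comment> \<open>The modulus of the integrand is the normal density, so the inner integral of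
      the norm is 1 for almost every \<open>u\<close>.\<close>
    have "integrable N (\<lambda>u. 1::real)" by simp
    then show "integrable N (\<lambda>u. LINT x|lborel. norm
        (case (u, x) of (u, x) \<Rightarrow> normal_density 0 (sqrt u) x *\<^sub>R iexp (t * x)))"
      by (rule integrable_cong_AE_imp) (use pos in \<open>auto simp: case_prod_beta'\<close>)
  qed (simp add: case_prod_beta')
  have nonneg: "0 \<le> g x" for x
    unfolding g by simp
  have "char (density lborel (\<lambda>x. ennreal (g x))) t = (CLINT x|lborel. g x *\<^sub>R iexp (t * x))"
    unfolding char_def using nonneg by (subst integral_density) auto
  also have "\<dots> = (CLINT x|lborel. (CLINT u|N. normal_density 0 (sqrt u) x *\<^sub>R iexp (t * x)))"
    by (simp add: g scaleR_conv_of_real del: integral_scaleR_left)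
  also have "\<dots> = (CLINT u|N. (CLINT x|lborel. normal_density 0 (sqrt u) x *\<^sub>R iexp (t * x)))"
    by (rule P.Fubini_integral[OF int])
  also have "\<dots> = (CLINT u|N. complex_of_real (exp (- (t\<^sup>2 * u / 2))))"
    by (rule integral_cong_AE) (use pos kernel in \<open>auto simp: case_prod_beta'\<close>)
  finally show "char (density lborel (\<lambda>x. ennreal (g x))) t = complex_of_real (LINT u|N. exp (- (t\<^sup>2 * u / 2)))"
    by simp
qed (use assms in auto)

section \<open>The Gamma distribution\<close>

text \<open>Gamma law of shape \<open>a\<close> and rate 1, written in the shape of the integrand in
  \<open>Gamma_conv_nn_integral_real\<close>.\<close>

definition gamma_density :: "real \<Rightarrow> real \<Rightarrow> real" where
  "gamma_density a v = indicator {0..} v * v powr (a - 1) / exp v / Gamma a"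

lemma gamma_density_measurable [measurable]: "gamma_density a \<in> borel_measurable borel"
  unfolding gamma_density_def by measurable

lemma gamma_density_nonneg: "a > 0 \<Longrightarrow> 0 \<le> gamma_density a v"
  by (simp add: gamma_density_def)

lemma has_bochner_integral_Gamma:
  assumes "a > 0"
  shows "has_bochner_integral lborel (\<lambda>v::real. indicator {0..} v * v powr (a - 1) / exp v) (Gamma a)"
  using assms
  by (intro has_bochner_integral_nn_integral) (auto simp: Gamma_conv_nn_integral_real)

lemma prob_space_gamma_density:
  assumes "a > 0"
  shows "prob_space (density lborel (gamma_density a))"
proof
  have "has_bochner_integral lborel (gamma_density a) 1"
    using has_bochner_integral_divide[OF has_bochner_integral_Gamma[OF assms], of "Gamma a"] assms
    unfolding gamma_density_def[abs_def] by (simp add: order_less_imp_not_eq2[OF Gamma_real_pos])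
  then have "(\<integral>\<^sup>+v. gamma_density a v \<partial>lborel) = 1"
    using assms by (subst nn_integral_eq_integral) (auto simp: has_bochner_integral_iff gamma_density_nonneg)
  then show "emeasure (density lborel (gamma_density a)) (space (density lborel (gamma_density a))) = 1"
    by (simp add: emeasure_density)
qed

lemma AE_gamma_density_pos: "AE v in density lborel (gamma_density a). 0 < v"
proof -
  have "AE v in lborel. v \<noteq> (0::real)" by (rule AE_lborel_singleton)
  then show ?thesis
    by (subst AE_density) (auto elim!: eventually_mono simp: gamma_density_def indicator_def split: if_splits)
qed

text \<open>Substituting \<open>c * v\<close> in the Gamma integral pulls out
  \<open>c powr a\<close>. With \<open>c = 1 + (q - 1) * x\<^sup>2\<close> this produces the power
  in the q-Gaussian density.\<close>

lemma Gamma_integral_scaled: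
  fixes a c :: real
  assumes "a > 0" "c > 0"
  shows "(LINT v|lborel. indicator {0..} v * v powr (a - 1) * exp (- (c * v))) = Gamma a / c powr a"
proof -
  have "Gamma a = (LINT v|lborel. indicator {0..} v * v powr (a - 1) / exp v)"
    using has_bochner_integral_Gamma[OF assms(1)] by (simp add: has_bochner_integral_iff)
  also have "\<dots> = \<bar>c\<bar> *\<^sub>R (LINT v|lborel. indicator {0..} (0 + c * v) * (0 + c * v) powr (a - 1) / exp (0 + c * v))"
    using assms by (intro lborel_integral_real_affine) auto
  also have "\<dots> = (LINT v|lborel. c powr a * (indicator {0..} v * v powr (a - 1) * exp (- (c * v))))"
    unfolding integral_scaleR_right[symmetric]
  proof (rule Bochner_Integration.integral_cong[OF refl])
    fix v :: real
    have "c * c powr (a - 1) = c powr a"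
      using assms powr_mult_base[of c "a - 1"] by simp
    then show "\<bar>c\<bar> *\<^sub>R (indicator {0..} (0 + c * v) * (0 + c * v) powr (a - 1) / exp (0 + c * v)) =
        c powr a * (indicator {0..} v * v powr (a - 1) * exp (- (c * v)))"
      using assms by (auto simp: indicator_def powr_mult exp_minus field_simps zero_le_mult_iff)
  qed
  also have "\<dots> = c powr a * (LINT v|lborel. indicator {0..} v * v powr (a - 1) * exp (- (c * v)))"
    by simp
  finally show ?thesis using assms by (simp add: field_simps)
qed

section \<open>The q-Gaussian for 1 < q < 3\<close>

text \<open>The variance is chosen so that the Gaussian exponent is linear in \<open>v\<close> with
  coefficient \<open>(q - 1) * x\<^sup>2\<close>; the factor \<open>exp (- v)\<close> of the Gamma
  density adds 1 to it. The normalisation contributes \<open>sqrt v\<close>, raising the shape from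
  \<open>a\<close> to \<open>a + 1 / 2 = 1 / (q - 1)\<close>.\<close>

lemma q_gaussian_density_as_mixture:
  assumes "1 < q" "q < 3"
  defines "a \<equiv> (3 - q) / (2 * (q - 1))"
  shows "q_gaussian_density q x =
    (LINT v|density lborel (gamma_density a). normal_density 0 (sqrt (1 / (2 * (q - 1) * v))) x)"
proof -
  have a: "a > 0" and a': "a + 1 / 2 = 1 / (q - 1)"
    using assms by (auto simp: a_def field_simps)
  have base: "1 + (q - 1) * x\<^sup>2 > 0"
    using assms by (intro add_pos_nonneg) auto
  have "(LINT v|density lborel (gamma_density a). normal_density 0 (sqrt (1 / (2 * (q - 1) * v))) x)
     = (LINT v|lborel. gamma_density a v * normal_density 0 (sqrt (1 / (2 * (q - 1) * v))) x)"
    using a by (subst integral_density) (auto simp: gamma_density_nonneg normal_density_def)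
  also have "\<dots> = (LINT v|lborel. (sqrt (q - 1) / (sqrt pi * Gamma a)) *
      (indicator {0..} v * v powr (a + 1 / 2 - 1) * exp (- ((1 + (q - 1) * x\<^sup>2) * v))))"
  proof (rule Bochner_Integration.integral_cong[OF refl])
    fix v :: real
    show "gamma_density a v * normal_density 0 (sqrt (1 / (2 * (q - 1) * v))) x =
      (sqrt (q - 1) / (sqrt pi * Gamma a)) *
      (indicator {0..} v * v powr (a + 1 / 2 - 1) * exp (- ((1 + (q - 1) * x\<^sup>2) * v)))"
    proof (cases "v > 0")
      case True
      have "v powr (a + 1 / 2 - 1) = v powr (a - 1) * sqrt v"
        using True by (simp add: powr_half_sqrt[symmetric] powr_add[symmetric] algebra_simps)
      moreover have "normal_density 0 (sqrt (1 / (2 * (q - 1) * v))) x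
          = sqrt (q - 1) * sqrt v / sqrt pi * exp (- ((q - 1) * x\<^sup>2 * v))"
      proof -
        have "1 / sqrt (2 * pi * (1 / (2 * (q - 1) * v))) = sqrt (q - 1) * sqrt v / sqrt pi"
        proof -
          have "sqrt (2 * pi * (1 / (2 * (q - 1) * v))) = sqrt (pi / ((q - 1) * v))"
            using True assms(1) by (intro arg_cong[of _ _ sqrt]) (simp add: divide_simps)
          also have "\<dots> = sqrt pi / (sqrt (q - 1) * sqrt v)"
            by (simp only: real_sqrt_divide real_sqrt_mult)
          finally show ?thesis by (simp only: divide_divide_eq_right mult_1)
        qed
        moreover have "- x\<^sup>2 / (2 * (1 / (2 * (q - 1) * v))) = - ((q - 1) * x\<^sup>2 * v)"
          by simp
        moreover have "(sqrt (1 / (2 * (q - 1) * v)))\<^sup>2 = 1 / (2 * (q - 1) * v)"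
          using True assms(1) by simp
        ultimately show ?thesis
          by (simp only: normal_density_def diff_0_right)
      qed
      moreover have "exp (- ((1 + (q - 1) * x\<^sup>2) * v)) = exp (- ((q - 1) * x\<^sup>2 * v)) / exp v"
        by (simp add: exp_diff[symmetric] algebra_simps)
      ultimately show ?thesis using True by (simp add: gamma_density_def mult_ac)
    next
      case False
      \<comment> \<open>At \<open>v = 0\<close> the indicator is 1, but both sides vanish since
        \<open>0 powr\<close> anything is 0.\<close>
      then show ?thesis by (cases "v = 0") (auto simp: gamma_density_def)
    qed
  qed
  also have "\<dots> = sqrt (q - 1) / (sqrt pi * Gamma a) *
      (Gamma (a + 1 / 2) / (1 + (q - 1) * x\<^sup>2) powr (a + 1 / 2))"
    using Gamma_integral_scaled[OF _ base, of "a + 1 / 2"] a by simp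
  also have "\<dots> = q_gaussian_density q x"
  proof -
    have e: "1 / (1 - q) = - (1 / (q - 1))"
      using assms by (simp add: field_simps)
    have const: "q_gaussian_const q = sqrt (q - 1) * Gamma (1 / (q - 1)) / (sqrt pi * Gamma a)"
      using assms(1) by (simp add: q_gaussian_const_def a_def)
    have "1 - (1 - q) * x\<^sup>2 = 1 + (q - 1) * x\<^sup>2"
      by (simp add: algebra_simps)
    then have "q_gaussian_density q x = q_gaussian_const q * (1 + (q - 1) * x\<^sup>2) powr - (1 / (q - 1))"
      using assms(1) by (simp only: q_gaussian_density_def q_gaussian_support_def e) simp
    then show ?thesis
      unfolding a' const powr_minus by (simp only: divide_inverse mult_ac)
  qed
  finally show ?thesis by simp
qed

lemma q_gaussian_density_measurable [measurable]: "q_gaussian_density q \<in> borel_measurable borel"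
  unfolding q_gaussian_density_def[abs_def] q_gaussian_support_def by measurable

lemma variance_mixture_of_normals_q_gaussian:
  assumes "1 < q" "q < 3"
  shows "variance_mixture_of_normals (q_gaussian q)"
  unfolding q_gaussian_def
proof (rule variance_mixture_of_normals_density)
  define G where "G = density lborel (gamma_density ((3 - q) / (2 * (q - 1))))"
  \<comment> \<open>The mixing law of the variance is an inverse Gamma distribution.\<close>
  define N where "N = distr G borel (\<lambda>v. 1 / (2 * (q - 1) * v))"
  have [measurable_cong]: "sets G = sets borel" by (simp add: G_def)
  interpret G: prob_space G
    unfolding G_def using assms by (intro prob_space_gamma_density) auto
  show "real_distribution N"
    unfolding N_def by (rule G.real_distribution_distr) measurable
  have "AE v in G. 0 < v"
    unfolding G_def by (rule AE_gamma_density_pos)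
  then show "AE u in N. 0 < u"
    unfolding N_def using assms by (subst AE_distr_iff) (auto elim!: eventually_mono)
  show "q_gaussian_density q x = (LINT u|N. normal_density 0 (sqrt u) x)" for x
    unfolding N_def using q_gaussian_density_as_mixture[OF assms, of x]
    by (subst integral_distr) (auto simp: G_def normal_density_def)
qed measurable

section \<open>The q-Gaussian for q < 1\<close>

text \<open>Given \<open>u\<close>, the variable \<open>sqrt u * z\<close> has the standard normal
  characteristic function at \<open>t * sqrt u\<close>; integrating over \<open>u\<close> gives the
  mixture. Realising the mixture as a product allows its support to be examined, and
  \<open>u = 0\<close> correctly gives a point mass.\<close>

lemma char_scale_mixture:
  assumes "real_distribution N" and nonneg: "AE u in N. 0 \<le> u"
  defines "D \<equiv> distr (N \<Otimes>\<^sub>M std_normal_distribution) borel (\<lambda>(u, z). sqrt u * z)"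
  shows "real_distribution D"
    and "char D t = complex_of_real (LINT u|N. exp (- (t\<^sup>2 * u / 2)))"
proof -
  interpret N: real_distribution N by fact
  interpret Z: real_distribution std_normal_distribution by (rule real_dist_normal_dist)
  interpret P: pair_prob_space N std_normal_distribution ..
  have [measurable]: "(\<lambda>(u, z). sqrt u * z) \<in> borel_measurable (N \<Otimes>\<^sub>M std_normal_distribution)"
    by (simp add: case_prod_beta')
  show "real_distribution D"
    unfolding D_def by (rule P.real_distribution_distr) measurable
  have int: "integrable (N \<Otimes>\<^sub>M std_normal_distribution) (\<lambda>(u, z). iexp (t * (sqrt u * z)))"
    unfolding case_prod_beta' by (rule P.integrable_iexp) auto
  have "char D t = (CLINT p|N \<Otimes>\<^sub>M std_normal_distribution. (case p of (u, z) \<Rightarrow> iexp (t * (sqrt u * z))))"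
    unfolding D_def char_def by (subst integral_distr) (auto simp: case_prod_beta')
  also have "\<dots> = (CLINT u|N. (CLINT z|std_normal_distribution. iexp (t * (sqrt u * z))))"
    by (rule P.integral_fst[OF int, symmetric])
  also have "\<dots> = (CLINT u|N. char std_normal_distribution (t * sqrt u))"
    by (simp add: char_def mult.assoc)
  also have "\<dots> = (CLINT u|N. complex_of_real (exp (- (t\<^sup>2 * u / 2))))"
    unfolding char_std_normal_distribution
    by (rule integral_cong_AE)
       (use nonneg in \<open>auto elim!: eventually_mono simp: power_mult_distrib\<close>)
  finally show "char D t = complex_of_real (LINT u|N. exp (- (t\<^sup>2 * u / 2)))"
    by simp
qed

text \<open>For almost every \<open>u\<close>, the slice at \<open>u\<close> inherits both almost
  sure conditions. The slice at \<open>u = 0\<close> is always 0, and a slice at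
  \<open>u > 0\<close> is unbounded, so no \<open>u\<close> is possible.\<close>

lemma not_variance_mixture_of_normals_bounded:
  fixes M :: "real measure"
  assumes M: "finite_borel_measure M" and bound: "AE x in M. \<bar>x\<bar> \<le> R" and nonzero: "AE x in M. x \<noteq> 0"
  shows "\<not> variance_mixture_of_normals M"
proof
  assume "variance_mixture_of_normals M"
  then obtain N where N: "real_distribution N" "AE u in N. 0 \<le> u"
    and char: "\<And>t. char M t = complex_of_real (LINT u|N. exp (- (t\<^sup>2 * u / 2)))"
    unfolding variance_mixture_of_normals_iff by blast
  interpret M: finite_borel_measure M by fact
  interpret N: real_distribution N by fact
  interpret Z: real_distribution std_normal_distribution by (rule real_dist_normal_dist)
  interpret P: pair_prob_space N std_normal_distribution ..
  define D where "D = distr (N \<Otimes>\<^sub>M std_normal_distribution) borel (\<lambda>(u, z). sqrt u * z)"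
  have [measurable]: "(\<lambda>(u, z). sqrt u * z) \<in> borel_measurable (N \<Otimes>\<^sub>M std_normal_distribution)"
    by (simp add: case_prod_beta')
  note D = char_scale_mixture[OF N, folded D_def]
  \<comment> \<open>At \<open>t = 0\<close> the characteristic function is the total mass; this
    makes \<open>M\<close> a probability measure, as Levy's uniqueness theorem requires.\<close>
  have "complex_of_real (measure M (space M)) = 1"
    using char[of 0] N.prob_space by (simp add: char_def scaleR_conv_of_real del: N.space_eq_univ)
  then have "real_distribution M"
    using M.M_is_borel M.borel_UNIV
    by (auto simp: real_distribution_def real_distribution_axioms_def M.emeasure_eq_measure intro!: prob_spaceI)
  then have "M = D"
    by (rule Levy_uniqueness) (auto simp: D char)
  with bound nonzero have "AE x in D. \<bar>x\<bar> \<le> R \<and> x \<noteq> 0" by auto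
  then have "AE p in N \<Otimes>\<^sub>M std_normal_distribution. (case p of (u, z) \<Rightarrow> \<bar>sqrt u * z\<bar> \<le> R \<and> sqrt u * z \<noteq> 0)"
    unfolding D_def by (subst (asm) AE_distr_iff) (auto simp: case_prod_beta')
  then have "AE u in N. AE z in std_normal_distribution. \<bar>sqrt u * z\<bar> \<le> R \<and> sqrt u * z \<noteq> 0"
    using P.AE_pair by force
  with N(2) have "AE u in N. False"
  proof eventually_elim
    case (elim u)
    \<comment> \<open>The normal density is positive everywhere, so its null sets are Lebesgue null
      sets.\<close>
    then have ae: "AE z in lborel. \<bar>sqrt u * z\<bar> \<le> R \<and> sqrt u * z \<noteq> 0"
      by (subst (asm) AE_density) (auto simp: normal_density_pos)
    have "u > 0"
    proof (rule ccontr)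
      assume "\<not> u > 0"
      with elim have "u = 0" by simp
      with ae show False by (simp add: ae_filter_eq_bot_iff)
    qed
    \<comment> \<open>Beyond \<open>b\<close> the product \<open>sqrt u * z\<close> exceeds
      \<open>R\<close>. The maximum with 0 keeps \<open>b\<close> nonnegative even for negative
      \<open>R\<close>, so the excluded interval of length 1 contains only positive
      \<open>z\<close>.\<close>
    define b where "b = max 0 R / sqrt u"
    have "AE z in lborel. z \<notin> {b<..b + 1}"
      using ae
    proof eventually_elim
      case (elim z)
      have "z \<le> b" if "z > 0"
        using elim that \<open>u > 0\<close> by (auto simp: b_def field_simps abs_mult)
      moreover have "b \<ge> 0" using \<open>u > 0\<close> by (simp add: b_def)
      ultimately show ?case by force
    qed
    then have "emeasure lborel {b<..b + 1} = 0"
      by (rule AE_iff_measurable[THEN iffD1, rotated 2]) auto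
    then show False by simp
  qed
  then show False by (simp add: N.AE_False)
qed

lemma not_variance_mixture_of_normals_q_gaussian:
  assumes "q < 1"
  shows "\<not> variance_mixture_of_normals (q_gaussian q)"
proof (rule not_variance_mixture_of_normals_bounded)
  define R where "R = 1 / sqrt (1 - q)"
  \<comment> \<open>A bounded density on a compact interval has finite mass. The absolute value
    avoids determining the sign of the constant.\<close>
  have bound: "q_gaussian_density q x \<le> \<bar>q_gaussian_const q\<bar> * indicator {-R..R} x" for x
  proof (cases "x \<in> q_gaussian_support q")
    case True
    then have x: "\<bar>x\<bar> \<le> R" using assms by (auto simp: q_gaussian_support_def R_def)
    have "x\<^sup>2 \<le> R\<^sup>2" using x by (intro abs_le_square_iff[THEN iffD1]) auto
    then have "(1 - q) * x\<^sup>2 \<le> 1"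
      using assms by (simp add: R_def power_divide field_simps)
    moreover have "0 \<le> (1 - q) * x\<^sup>2" using assms by simp
    ultimately have "(1 - (1 - q) * x\<^sup>2) powr (1 / (1 - q)) \<le> 1"
      using assms by (intro powr_le1) auto
    then have "q_gaussian_const q * (1 - (1 - q) * x\<^sup>2) powr (1 / (1 - q)) \<le> \<bar>q_gaussian_const q\<bar> * 1"
      by (intro mult_mono) auto
    then show ?thesis using True x by (simp add: q_gaussian_density_def abs_le_iff)
  next
    case False
    then show ?thesis by (simp add: q_gaussian_density_def)
  qed
  have "(\<integral>\<^sup>+x. q_gaussian_density q x \<partial>lborel) \<le> (\<integral>\<^sup>+x. ennreal \<bar>q_gaussian_const q\<bar> * indicator {-R..R} x \<partial>lborel)"
    using bound by (intro nn_integral_mono) (auto simp: ennreal_mult[symmetric] ennreal_indicator[symmetric] intro!: ennreal_leI)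
  also have "\<dots> < \<infinity>"
    by (subst nn_integral_cmult_indicator) (auto simp: ennreal_mult_less_top emeasure_lborel_Icc_eq)
  finally show "finite_borel_measure (q_gaussian q)"
    unfolding finite_borel_measure_def finite_borel_measure_axioms_def q_gaussian_def
    by (auto intro!: finite_measureI simp: emeasure_density)
  show "AE x in q_gaussian q. \<bar>x\<bar> \<le> R"
    unfolding q_gaussian_def using assms
    by (subst AE_density) (auto simp: q_gaussian_density_def q_gaussian_support_def R_def abs_le_iff split: if_splits)
  have "AE x in lborel. x \<noteq> (0::real)" by (rule AE_lborel_singleton)
  then show "AE x in q_gaussian q. x \<noteq> 0"
    unfolding q_gaussian_def by (subst AE_density) (auto elim: eventually_mono)
qed

theorem theorem2p1:
  shows "(\<forall>q::real. 1 < q \<and> q < 3 \<longrightarrow> variance_mixture_of_normals (q_gaussian q)) \<and>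
         (\<forall>q::real. q < 1 \<longrightarrow> \<not> variance_mixture_of_normals (q_gaussian q))"
  using variance_mixture_of_normals_q_gaussian not_variance_mixture_of_normals_q_gaussian by blast

end
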